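(* Let $M:\mathbb{R}^d\rightrightarrows\mathbb{R}^d$ be a set-valued operator with $X_*(M)\neq\emptyset$ that is maximal $\gamma$-weakly monotone for some $\gamma\ge 0$ and satisfies the weak MVI condition with some $\rho\ge 0$. Let $h$ be a Legendre function that is $\mu_h$-strongly convex and $L_h$-smooth with $\mu_h>\gamma$ and $\rho L_h<1$. Then the sequence $\{x_k\}$ of the Bregman proximal point method $x_{k+1}=R(x_k)$, $k=0,1,\dots$, satisfies, for every $k\ge 1$ and every $x_*\in X_*^\rho(M)$, $$\min_{i=1,\ldots,k} D_h(x_i,x_{i-1})\le \frac{D_h(x_*,x_0)}{(1-\rho L_h)\,k}.$$ Moreover, all limit points of the sequence $\{x_k\}$ are in $X_*(M)$, and if we further assume that $X_*^\rho(M)=X_*(M)$, then the sequence $\{x_k\}$ converges to a solution $x_*\in X_*^\rho(M)$.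
   Context: $\mathbb{R}^d$ carries the Euclidean inner product and norm. For a set-valued operator $M$, $\operatorname{gra}M=\{(x,w):w\in Mx\}$ and $X_*(M)=\{x_*: 0\in Mx_*\}$ (assumed nonempty). $M$ is $\gamma$-weakly monotone if $\langle x-y,w-z\rangle\ge-\gamma\|x-y\|^2$ for all $(x,w),(y,z)\in\operatorname{gra}M$; it is maximal if no $\gamma$-weakly monotone operator has a graph properly containing $\operatorname{gra}M$. Weak MVI condition with $\rho\ge0$: there exists $x_*\in X_*(M)$ such that $\langle x-x_*,w\rangle\ge-\frac{\rho}{2}\|w\|^2$ for all $(x,w)\in\operatorname{gra}M$. $X_*^\rho(M)$ denotes the set of all $x_*\in X_*(M)$ with this property. A Legendre function $h:\mathbb{R}^d\to(-\infty,\infty]$ is a closed, proper, strictly convex function that is essentially smooth: $\operatorname{int}\operatorname{dom}h\neq\emptyset$, $h$ is differentiable on $\operatorname{int}\operatorname{dom}h$, and $\|\nabla h(x_k)\|\to\infty$ whenever $\{x_k\}\subset\operatorname{int}\operatorname{dom}h$ converges to a boundary point of $\operatorname{int}\operatorname{dom}h$. $h$ is $L_h$-smooth if $\nabla h$ is $L_h$-Lipschitz continuous; $h$ is $\mu_h$-strongly convex if $h-\frac{\mu_h}{2}\|\cdot\|^2$ is convex. The Bregman distance is $D_h(x,y)=h(x)-h(y)-\langle\nabla h(y),x-y\rangle$ for $x\in\operatorname{dom}h$, $y\in\operatorname{int}\operatorname{dom}h$. The $h$-resolvent of $M$ is $R=(\nabla h+M)^{-1}\nabla h$, i.e. $y\in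 R(x)$ iff $\nabla h(x)-\nabla h(y)\in My$; under the hypotheses it is single-valued. The initial point $x_0$ is arbitrary in $\operatorname{int}\operatorname{dom}h$. *)

theory Defs
  imports "HOL-Analysis.Analysis"
begin

section \<open>Extended-real-valued convex functions\<close>

definition edom :: "('a \<Rightarrow> ereal) \<Rightarrow> 'a set"
  where "edom h = {x. h x < \<infinity>}"

definition proper_fun :: "('a \<Rightarrow> ereal) \<Rightarrow> bool"
  where "proper_fun h \<longleftrightarrow> (\<forall>x. h x \<noteq> -\<infinity>) \<and> edom h \<noteq> {}"

definition closed_fun :: "('a::euclidean_space \<Rightarrow> ereal) \<Rightarrow> bool"
  where "closed_fun h \<longleftrightarrow> closed {(x, r::real). h x \<le> ereal r}"

text \<open>Both notions below are used only for functions that avoid the value minus infinity, so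
  that no sum of infinities of opposite sign occurs.\<close>

definition convex_fun :: "('a::euclidean_space \<Rightarrow> ereal) \<Rightarrow> bool"
  where "convex_fun h \<longleftrightarrow>
    (\<forall>x y. \<forall>t::real. 0 < t \<and> t < 1 \<longrightarrow>
      h ((1 - t) *\<^sub>R x + t *\<^sub>R y) \<le> ereal (1 - t) * h x + ereal t * h y)"

definition strictly_convex_fun :: "('a::euclidean_space \<Rightarrow> ereal) \<Rightarrow> bool"
  where "strictly_convex_fun h \<longleftrightarrow>
    (\<forall>x\<in>edom h. \<forall>y\<in>edom h. \<forall>t::real. x \<noteq> y \<and> 0 < t \<and> t < 1 \<longrightarrow>
      h ((1 - t) *\<^sub>R x + t *\<^sub>R y) < ereal (1 - t) * h x + ereal t * h y)"

definition strongly_convex_fun :: "real \<Rightarrow> ('a::euclidean_space \<Rightarrow> ereal) \<Rightarrow> bool"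
  where "strongly_convex_fun \<mu> h \<longleftrightarrow> convex_fun (\<lambda>x. h x - ereal (\<mu> / 2 * (norm x)\<^sup>2))"

text \<open>The gradient is only meaningful, and only used, on the interior of the domain, where
  \<^term>\<open>h\<close> is finite and hence agrees locally with its real part.\<close>

definition grad :: "('a::euclidean_space \<Rightarrow> ereal) \<Rightarrow> 'a \<Rightarrow> 'a"
  where "grad h x = (THE g. GDERIV (\<lambda>z. real_of_ereal (h z)) x :> g)"

definition essentially_smooth :: "('a::euclidean_space \<Rightarrow> ereal) \<Rightarrow> bool"
  where "essentially_smooth h \<longleftrightarrow>
    interior (edom h) \<noteq> {} \<and>
    (\<forall>x\<in>interior (edom h). (\<lambda>z. real_of_ereal (h z)) differentiable (at x)) \<and>
    (\<forall>s p. (\<forall>k::nat. s k \<in> interior (edom h)) \<and> p \<in> frontier (interior (edom h)) \<and>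
        s \<longlonglongrightarrow> p \<longrightarrow>
      filterlim (\<lambda>k. norm (grad h (s k))) at_top sequentially)"

definition legendre_fun :: "('a::euclidean_space \<Rightarrow> ereal) \<Rightarrow> bool"
  where "legendre_fun h \<longleftrightarrow>
    closed_fun h \<and> proper_fun h \<and> strictly_convex_fun h \<and> essentially_smooth h"

definition smooth_fun :: "real \<Rightarrow> ('a::euclidean_space \<Rightarrow> ereal) \<Rightarrow> bool"
  where "smooth_fun L h \<longleftrightarrow> L-lipschitz_on (interior (edom h)) (grad h)"

text \<open>Meant for \<^term>\<open>x \<in> edom h\<close> and \<^term>\<open>y \<in> interior (edom h)\<close>, where the value is finite.\<close>

definition bregman :: "('a::euclidean_space \<Rightarrow> ereal) \<Rightarrow> 'a \<Rightarrow> 'a \<Rightarrow> ereal"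
  where "bregman h x y = h x - h y - ereal (inner (grad h y) (x - y))"

section \<open>Set-valued operators\<close>

definition gra :: "('a \<Rightarrow> 'b set) \<Rightarrow> ('a \<times> 'b) set"
  where "gra M = {(x, w). w \<in> M x}"

definition zeros :: "('a \<Rightarrow> 'b::zero set) \<Rightarrow> 'a set"
  where "zeros M = {x. 0 \<in> M x}"

definition weakly_monotone :: "real \<Rightarrow> ('a::euclidean_space \<Rightarrow> 'a set) \<Rightarrow> bool"
  where "weakly_monotone \<gamma> M \<longleftrightarrow>
    (\<forall>(x, w)\<in>gra M. \<forall>(y, z)\<in>gra M. inner (x - y) (w - z) \<ge> - \<gamma> * (norm (x - y))\<^sup>2)"

definition maximal_weakly_monotone :: "real \<Rightarrow> ('a::euclidean_space \<Rightarrow> 'a set) \<Rightarrow> bool"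
  where "maximal_weakly_monotone \<gamma> M \<longleftrightarrow>
    weakly_monotone \<gamma> M \<and> \<not> (\<exists>N. weakly_monotone \<gamma> N \<and> gra M \<subset> gra N)"

definition weak_MVI_zeros :: "real \<Rightarrow> ('a::euclidean_space \<Rightarrow> 'a set) \<Rightarrow> 'a set"
  where "weak_MVI_zeros \<rho> M =
    {xs \<in> zeros M. \<forall>(x, w)\<in>gra M. inner (x - xs) w \<ge> - (\<rho> / 2) * (norm w)\<^sup>2}"

definition weak_MVI :: "real \<Rightarrow> ('a::euclidean_space \<Rightarrow> 'a set) \<Rightarrow> bool"
  where "weak_MVI \<rho> M \<longleftrightarrow>
    (\<exists>xs\<in>zeros M. \<forall>(x, w)\<in>gra M. inner (x - xs) w \<ge> - (\<rho> / 2) * (norm w)\<^sup>2)"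

text \<open>The resolvent as a set-valued map; the gradient restricts its values (and the
  arguments of interest) to the interior of the domain.\<close>

definition resolvent ::
    "('a::euclidean_space \<Rightarrow> ereal) \<Rightarrow> ('a \<Rightarrow> 'a set) \<Rightarrow> 'a \<Rightarrow> 'a set"
  where "resolvent h M x = {y \<in> interior (edom h). grad h x - grad h y \<in> M y}"

text \<open>A sequence in place of its range: a value attained infinitely often counts as a limit point.\<close>

definition limit_point_of_seq :: "(nat \<Rightarrow> 'a::topological_space) \<Rightarrow> 'a \<Rightarrow> bool"
  where "limit_point_of_seq x p \<longleftrightarrow> (\<exists>r::nat \<Rightarrow> nat. strict_mono r \<and> (x \<circ> r) \<longlonglongrightarrow> p)"

end

theory Submission
  imports Defs
begin

text \<open>
  Lipschitz continuity of the gradient is incompatible with the blow-up that essential smoothness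
  demands at the boundary of the domain, so \<^term>\<open>h\<close> is finite everywhere
  (\<open>interior_edom_eq_UNIV\<close>) and the problem concerns an ordinary differentiable function
  \<^term>\<open>f\<close> with gradient \<^term>\<open>g\<close>. Its Bregman distance \<^term>\<open>D\<close> has a quadratic lower bound by strong
  convexity, and it dominates the squared variation of the gradient by cocoercivity:
  \<open>norm (g x - g y)^2 \<le> 2 L D(x, y)\<close> (\<open>gradient_cocoercive\<close>).

  Put \<open>w = g (x k) - g (x (k + 1))\<close>, an element of \<open>M (x (k + 1))\<close>. The three-point identity
  expresses \<open>D(p, x k) - D(p, x (k + 1)) - D(x (k + 1), x k)\<close> as the inner product of
  \<open>x (k + 1) - p\<close> and \<open>w\<close>. For a weak MVI solution \<open>p\<close> this is at least \<open>- (\<rho>/2) norm w ^ 2\<close>, hence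
  at least \<open>- \<rho> L D(x (k + 1), x k)\<close> by cocoercivity. So \<open>D(p, x k)\<close> decreases in every step by at
  least \<open>(1 - \<rho> L) D(x (k + 1), x k)\<close> (\<open>bregman_step_decrease\<close>). Telescoping yields the rate, and it
  also shows that \<open>D(x (k + 1), x k)\<close> tends to zero; by cocoercivity the elements \<open>w\<close> of the
  operator values along the sequence then tend to zero too. A maximal weakly monotone operator has
  a closed graph (\<open>maximal_weakly_monotone_closed_graph\<close>), so every limit point is a zero.

  Finally the iterates are bounded, since \<open>D(p, x k)\<close> is decreasing and bounds the distance to \<open>p\<close>.
  So they have a limit point, and when that limit point is itself a weak MVI solution, the
  distances \<open>D\<close> from it decrease along the whole sequence and vanish along a subsequence; hence
  they vanish altogether.
\<close>

section \<open>Convex functions with Lipschitz gradient\<close>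

definition real_bregman :: "('a::real_inner \<Rightarrow> real) \<Rightarrow> ('a \<Rightarrow> 'a) \<Rightarrow> 'a \<Rightarrow> 'a \<Rightarrow> real"
  where "real_bregman f g x y = f x - f y - inner (g y) (x - y)"

lemma has_real_derivative_along_line:
  fixes f :: "'a::real_inner \<Rightarrow> real"
  assumes "GDERIV f (a + t *\<^sub>R d) :> g"
  shows "((\<lambda>s. f (a + s *\<^sub>R d)) has_real_derivative inner g d) (at t)"
proof -
  have "((\<lambda>s. a + s *\<^sub>R d) has_derivative (\<lambda>s. s *\<^sub>R d)) (at t)"
    by (auto intro!: derivative_eq_intros)
  from diff_chain_at[OF this assms[unfolded gderiv_def]]
  have "((\<lambda>s. f (a + s *\<^sub>R d)) has_derivative (\<lambda>s. inner (s *\<^sub>R d) g)) (at t)"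
    by (simp add: o_def)
  moreover have "(\<lambda>s. inner (s *\<^sub>R d) g) = (*) (inner g d)"
    by (auto simp: inner_commute)
  ultimately show ?thesis by (simp add: has_field_derivative_def)
qed

text \<open>Restricting to the segment reduces this to the one-dimensional tangent inequality.\<close>

lemma convex_on_gradient_inequality:
  fixes f :: "'a::real_inner \<Rightarrow> real"
  assumes conv: "convex_on UNIV f" and grd: "GDERIV f y :> g"
  shows "f x - f y \<ge> inner g (x - y)"
proof -
  let ?p = "\<lambda>t. f (y + t *\<^sub>R (x - y))"
  have "convex_on UNIV ?p"
  proof (rule convex_onI)
    fix t a b :: real assume "0 < t" "t < 1"
    moreover have "y + ((1 - t) *\<^sub>R a + t *\<^sub>R b) *\<^sub>R (x - y)
      = (1 - t) *\<^sub>R (y + a *\<^sub>R (x - y)) + t *\<^sub>R (y + b *\<^sub>R (x - y))"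
      by (simp add: algebra_simps)
    ultimately show "?p ((1 - t) *\<^sub>R a + t *\<^sub>R b) \<le> (1 - t) * ?p a + t * ?p b"
      using convex_onD[OF conv, of t "y + a *\<^sub>R (x - y)" "y + b *\<^sub>R (x - y)"] by simp
  qed simp
  moreover have "(?p has_real_derivative inner g (x - y)) (at 0)"
    by (rule has_real_derivative_along_line) (use grd in simp)
  ultimately have "?p 1 - ?p 0 \<ge> inner g (x - y) * (1 - 0)"
    by (intro convex_on_imp_above_tangent[where A = UNIV])
       (auto intro: has_field_derivative_at_within)
  then show ?thesis by simp
qed

text \<open>The quadratic term contributes exactly \<open>\<mu> / 2 * (norm (x - y))\<^sup>2\<close> to the Bregman distance,
  and the convex remainder contributes a nonnegative amount.\<close>

lemma strongly_convex_real_bregman_ge: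
  fixes f :: "'a::real_inner \<Rightarrow> real"
  assumes conv: "convex_on UNIV (\<lambda>x. f x - \<mu> / 2 * (norm x)\<^sup>2)"
    and grd: "GDERIV f y :> g y"
  shows "\<mu> / 2 * (norm (x - y))\<^sup>2 \<le> real_bregman f g x y"
proof -
  have "GDERIV (\<lambda>x. f x - \<mu> / 2 * (norm x)\<^sup>2) y :> g y - \<mu> *\<^sub>R y"
    using grd unfolding gderiv_def power2_norm_eq_inner
    by (auto intro!: derivative_eq_intros simp: inner_commute algebra_simps)
  from convex_on_gradient_inequality[OF conv this, of x] show ?thesis
    by (simp add: real_bregman_def power2_norm_eq_inner inner_diff inner_commute algebra_simps)
qed

text \<open>The difference of the two sides, restricted to the segment from \<^term>\<open>y\<close> to
  \<^term>\<open>x\<close>, vanishes at \<^term>\<open>y\<close> and has a derivative of constant sign by the Lipschitz bound.\<close>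

lemma lipschitz_gradient_real_bregman_le:
  fixes f :: "'a::real_inner \<Rightarrow> real"
  assumes grd: "\<And>z. GDERIV f z :> g z" and lip: "L-lipschitz_on UNIV g"
  shows "real_bregman f g x y \<le> L / 2 * (norm (x - y))\<^sup>2"
proof -
  let ?d = "x - y"
  let ?p = "\<lambda>t. f (y + t *\<^sub>R ?d) - t * inner (g y) ?d - L / 2 * t\<^sup>2 * (norm ?d)\<^sup>2"
  have "?p 1 \<le> ?p 0"
  proof (rule DERIV_nonpos_imp_nonincreasing[where f = ?p])
    fix t :: real assume t: "0 \<le> t" "t \<le> 1"
    have "(?p has_real_derivative
        inner (g (y + t *\<^sub>R ?d)) ?d - inner (g y) ?d - L * t * (norm ?d)\<^sup>2) (at t)"
      by (auto intro!: derivative_eq_intros has_real_derivative_along_line grd)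
    moreover have "inner (g (y + t *\<^sub>R ?d)) ?d - inner (g y) ?d \<le> L * t * (norm ?d)\<^sup>2"
    proof -
      have "inner (g (y + t *\<^sub>R ?d) - g y) ?d \<le> norm (g (y + t *\<^sub>R ?d) - g y) * norm ?d"
        by (rule norm_cauchy_schwarz)
      also have "\<dots> \<le> (L * (t * norm ?d)) * norm ?d"
        using lipschitz_onD[OF lip, of "y + t *\<^sub>R ?d" y] t
        by (intro mult_right_mono) (auto simp: dist_norm)
      finally show ?thesis
        by (simp add: inner_diff_left power2_eq_square algebra_simps)
    qed
    ultimately show "\<exists>D. (?p has_real_derivative D) (at t) \<and> D \<le> 0"
      by (intro exI conjI) auto
  qed simp
  then show ?thesis by (simp add: real_bregman_def)
qed

text \<open>The tilted function \<open>z \<mapsto> f z - g y \<bullet> z\<close> is convex with minimizer \<^term>\<open>y\<close>. A gradient step of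
  length \<open>1 / L\<close> from \<^term>\<open>x\<close> decreases it by at least \<open>(norm (g x - g y))\<^sup>2 / (2 * L)\<close>,
  and it cannot fall below its minimum.\<close>

lemma gradient_cocoercive:
  fixes f :: "'a::real_inner \<Rightarrow> real"
  assumes conv: "convex_on UNIV f"
    and grd: "\<And>z. GDERIV f z :> g z" and lip: "L-lipschitz_on UNIV g"
  shows "(norm (g x - g y))\<^sup>2 \<le> 2 * L * real_bregman f g x y"
proof (cases "L = 0")
  case True
  then show ?thesis using lipschitz_onD[OF lip, of x y] by simp
next
  case False
  with lipschitz_on_nonneg[OF lip] have L: "L > 0" by simp
  define w where "w = g x - g y"
  define z where "z = x - (1 / L) *\<^sub>R w"
  have "inner (g y) (z - y) \<le> f z - f y"
    by (rule convex_on_gradient_inequality[OF conv grd])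
  moreover have "f z - f x - inner (g x) (z - x) \<le> L / 2 * (norm (z - x))\<^sup>2"
    using lipschitz_gradient_real_bregman_le[OF grd lip, of z x] by (simp add: real_bregman_def)
  moreover have "L / 2 * (norm (z - x))\<^sup>2 = (norm w)\<^sup>2 / (2 * L)"
    using L by (simp add: z_def power2_eq_square field_simps)
  moreover have "inner (g x) (z - x) = - inner (g x) w / L"
    by (simp add: z_def)
  moreover have "inner (g y) (z - y) = inner (g y) (x - y) - inner (g y) w / L"
    by (simp add: z_def inner_diff_right)
  moreover have "inner (g x) w / L - inner (g y) w / L = (norm w)\<^sup>2 / L"
    by (simp add: w_def power2_norm_eq_inner inner_diff_left diff_divide_distrib)
  moreover have "(norm w)\<^sup>2 / L - (norm w)\<^sup>2 / (2 * L) = (norm w)\<^sup>2 / (2 * L)"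
    by simp
  ultimately have "(norm w)\<^sup>2 / (2 * L) \<le> real_bregman f g x y"
    unfolding real_bregman_def by linarith
  then show ?thesis using L by (simp add: w_def field_simps)
qed

section \<open>Smooth Legendre functions are finite everywhere\<close>

lemma differentiable_imp_GDERIV:
  fixes f :: "'a::euclidean_space \<Rightarrow> real"
  assumes "f differentiable (at x)"
  obtains g where "GDERIV f x :> g"
proof -
  from assms obtain f' where f': "(f has_derivative f') (at x)"
    by (auto simp: differentiable_def)
  then interpret linear f' by (rule has_derivative_linear)
  have "f' = (\<lambda>v. inner v (\<Sum>b\<in>Basis. f' b *\<^sub>R b))"
  proof
    fix v
    have "f' v = f' (\<Sum>b\<in>Basis. inner v b *\<^sub>R b)" by (simp add: euclidean_representation)
    also have "\<dots> = inner v (\<Sum>b\<in>Basis. f' b *\<^sub>R b)"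
      by (simp add: sum scale inner_sum_right mult.commute)
    finally show "f' v = inner v (\<Sum>b\<in>Basis. f' b *\<^sub>R b)" .
  qed
  with f' have "GDERIV f x :> (\<Sum>b\<in>Basis. f' b *\<^sub>R b)" by (simp add: gderiv_def)
  then show thesis by (rule that)
qed

lemma GDERIV_unique:
  fixes f :: "'a::real_inner \<Rightarrow> real"
  assumes "GDERIV f x :> a" "GDERIV f x :> b"
  shows "a = b"
proof -
  have "(\<lambda>v. inner v a) = (\<lambda>v. inner v b)"
    using has_derivative_unique assms unfolding gderiv_def by blast
  then have "inner v (a - b) = 0" for v by (metis inner_diff_right right_minus_eq)
  then show ?thesis by (metis inner_eq_zero_iff right_minus_eq)
qed

lemma GDERIV_grad:
  assumes "essentially_smooth h" "x \<in> interior (edom h)"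
  shows "GDERIV (\<lambda>z. real_of_ereal (h z)) x :> grad h x"
proof -
  obtain g where g: "GDERIV (\<lambda>z. real_of_ereal (h z)) x :> g"
    using assms differentiable_imp_GDERIV unfolding essentially_smooth_def by metis
  then show ?thesis unfolding grad_def
    by (rule theI) (use GDERIV_unique g in blast)
qed

text \<open>A Lipschitz gradient stays bounded along a sequence that converges to a boundary point, whereas
  essential smoothness makes it blow up. So the interior of the domain has no boundary points,
  and by connectedness it is the whole space.\<close>

lemma interior_edom_eq_UNIV:
  fixes h :: "'a::euclidean_space \<Rightarrow> ereal"
  assumes es: "essentially_smooth h" and sm: "smooth_fun L h"
  shows "interior (edom h) = UNIV"
proof (rule ccontr)
  let ?U = "interior (edom h)"
  assume "?U \<noteq> UNIV"
  moreover have "?U \<noteq> {}" using es by (simp add: essentially_smooth_def)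
  ultimately obtain p where p: "p \<in> frontier ?U"
    using frontier_eq_empty by blast
  then have "p \<in> closure ?U" by (simp add: frontier_def)
  then obtain s where s: "\<And>k. s k \<in> ?U" "s \<longlonglongrightarrow> p"
    using closure_sequential by blast
  with es p have lim: "filterlim (\<lambda>k. norm (grad h (s k))) at_top sequentially"
    unfolding essentially_smooth_def by blast
  have lip: "L-lipschitz_on ?U (grad h)" using sm by (simp add: smooth_fun_def)
  have "eventually (\<lambda>k. dist (s k) p < 1) sequentially"
    using tendstoD[OF s(2)] by simp
  moreover have "eventually (\<lambda>k. norm (grad h (s 0)) + L * (1 + dist p (s 0)) + 1
      \<le> norm (grad h (s k))) sequentially"
    using lim by (simp add: filterlim_at_top)
  ultimately have "eventually (\<lambda>k. False) sequentially"
  proof eventually_elim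
    case (elim k)
    have "norm (grad h (s k)) \<le> norm (grad h (s 0)) + dist (grad h (s k)) (grad h (s 0))"
      by (metis dist_norm norm_triangle_sub add.commute)
    also have "dist (grad h (s k)) (grad h (s 0)) \<le> L * dist (s k) (s 0)"
      using lipschitz_onD[OF lip s(1) s(1)] .
    also have "L * dist (s k) (s 0) \<le> L * (1 + dist p (s 0))"
      using elim(1) dist_triangle[of "s k" "s 0" p] lipschitz_on_nonneg[OF lip]
      by (intro mult_left_mono) auto
    finally show False using elim(2) by simp
  qed
  then show False by simp
qed

section \<open>Closedness of the graph\<close>

text \<open>Weak monotonicity passes to limits, so adjoining a limit point to the graph keeps the operator
  weakly monotone; by maximality the point was there already.\<close>

lemma maximal_weakly_monotone_closed_graph:
  assumes max: "maximal_weakly_monotone \<gamma> M"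
    and mem: "\<And>k::nat. w k \<in> M (x k)" and lim: "x \<longlonglongrightarrow> p" "w \<longlonglongrightarrow> q"
  shows "q \<in> M p"
proof (rule ccontr)
  assume q: "q \<notin> M p"
  define N where "N = M(p := insert q (M p))"
  have wm: "weakly_monotone \<gamma> M" using max by (simp add: maximal_weakly_monotone_def)
  have grN: "gra N = insert (p, q) (gra M)" by (auto simp: gra_def N_def split: if_splits)
  have new: "- \<gamma> * (norm (p - y))\<^sup>2 \<le> inner (p - y) (q - z)" if "(y, z) \<in> gra M" for y z
  proof (rule tendsto_le)
    show "(\<lambda>k. inner (x k - y) (w k - z)) \<longlonglongrightarrow> inner (p - y) (q - z)"
      "(\<lambda>k. - \<gamma> * (norm (x k - y))\<^sup>2) \<longlonglongrightarrow> - \<gamma> * (norm (p - y))\<^sup>2"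
      using lim by (auto intro!: tendsto_intros)
    show "eventually (\<lambda>k. - \<gamma> * (norm (x k - y))\<^sup>2 \<le> inner (x k - y) (w k - z)) sequentially"
      using wm mem that unfolding weakly_monotone_def gra_def by (intro always_eventually) auto
  qed simp
  have "- \<gamma> * (norm (y - p))\<^sup>2 \<le> inner (y - p) (z - q)" if "(y, z) \<in> gra M" for y z
    using new[OF that] by (simp add: norm_minus_commute inner_diff algebra_simps)
  with new wm have "weakly_monotone \<gamma> N"
    unfolding weakly_monotone_def grN by auto
  moreover have "(p, q) \<notin> gra M" using q by (simp add: gra_def)
  then have "gra M \<subset> gra N" unfolding grN by blast
  ultimately show False using max by (auto simp: maximal_weakly_monotone_def)
qed

section \<open>Convergence of the Bregman proximal point method\<close>

text \<open>By the three-point identity the decrease equals \<^term>\<open>real_bregman f g y x\<close> plus the inner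
  product of \<^term>\<open>y - p\<close> and the operator value \<^term>\<open>g x - g y\<close>. The weak MVI
  condition bounds that product below by a multiple of the squared norm of this value, and
  cocoercivity turns the bound into a multiple of \<^term>\<open>real_bregman f g y x\<close>.\<close>

lemma bregman_step_decrease:
  fixes f :: "'a::euclidean_space \<Rightarrow> real"
  assumes conv: "convex_on UNIV f"
    and grd: "\<And>z. GDERIV f z :> g z" and lip: "L-lipschitz_on UNIV g"
    and rho: "\<rho> \<ge> 0" and p: "p \<in> weak_MVI_zeros \<rho> M" and step: "g x - g y \<in> M y"
  shows "real_bregman f g p y \<le> real_bregman f g p x - (1 - \<rho> * L) * real_bregman f g y x"
proof -
  let ?w = "g x - g y"
  have "real_bregman f g p x - real_bregman f g p y - real_bregman f g y x = inner (y - p) ?w"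
    by (simp add: real_bregman_def inner_diff inner_commute algebra_simps)
  moreover have "- (\<rho> / 2) * (norm ?w)\<^sup>2 \<le> inner (y - p) ?w"
    using p step by (auto simp: weak_MVI_zeros_def gra_def)
  moreover have "\<rho> / 2 * (norm ?w)\<^sup>2 \<le> \<rho> / 2 * (2 * L * real_bregman f g y x)"
    using gradient_cocoercive[OF conv grd lip, of y x] rho
    by (intro mult_left_mono) (auto simp: norm_minus_commute)
  ultimately show ?thesis by (simp add: algebra_simps)
qed

theorem theorem4p3:
  fixes M :: "real ^ 'n \<Rightarrow> (real ^ 'n) set"
    and h :: "real ^ 'n \<Rightarrow> ereal"
    and x :: "nat \<Rightarrow> real ^ 'n"
    and \<gamma> \<rho> \<mu> L :: real
  assumes "zeros M \<noteq> {}"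
    and "\<gamma> \<ge> 0" and "maximal_weakly_monotone \<gamma> M"
    and "\<rho> \<ge> 0" and "weak_MVI \<rho> M"
    and "legendre_fun h" and "strongly_convex_fun \<mu> h" and "smooth_fun L h"
    and "\<mu> > \<gamma>" and "\<rho> * L < 1"
    and "x 0 \<in> interior (edom h)"
    and "\<And>k. x (Suc k) \<in> resolvent h M (x k)"
  shows "(\<forall>k\<ge>1. \<forall>xs\<in>weak_MVI_zeros \<rho> M.
            (MIN i\<in>{1..k}. bregman h (x i) (x (i - 1)))
              \<le> bregman h xs (x 0) / ereal ((1 - \<rho> * L) * real k))
       \<and> (\<forall>p. limit_point_of_seq x p \<longrightarrow> p \<in> zeros M)
       \<and> (weak_MVI_zeros \<rho> M = zeros M \<longrightarrow>
            (\<exists>xs\<in>weak_MVI_zeros \<rho> M. x \<longlonglongrightarrow> xs))"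
proof -
  define f where "f = (\<lambda>z. real_of_ereal (h z))"
  define g where "g = grad h"
  define D where "D = real_bregman f g"
  define c where "c = 1 - \<rho> * L"
  have c: "c > 0" using assms(10) by (simp add: c_def)
  have mu: "\<mu> > 0" using assms(2,9) by simp

  have es: "essentially_smooth h" and pr: "proper_fun h"
    using assms(6) by (auto simp: legendre_fun_def)
  have U: "interior (edom h) = UNIV" by (rule interior_edom_eq_UNIV[OF es assms(8)])
  then have "edom h = UNIV" using interior_subset by blast
  then have fin: "h z < \<infinity>" "h z \<noteq> -\<infinity>" for z
    using pr by (auto simp: edom_def proper_fun_def)
  have h: "h z = ereal (f z)" for z unfolding f_def using fin[of z] by (cases "h z") auto
  have grd: "GDERIV f z :> g z" for z
    using GDERIV_grad[OF es] U by (simp add: f_def g_def)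
  have lip: "L-lipschitz_on UNIV g" using assms(8) U by (simp add: smooth_fun_def g_def)
  have sconv: "convex_on UNIV (\<lambda>z. f z - \<mu> / 2 * (norm z)\<^sup>2)"
  proof (rule convex_onI)
    fix t :: real and a b :: "real ^ 'n" assume "0 < t" "t < 1"
    then show "f ((1 - t) *\<^sub>R a + t *\<^sub>R b) - \<mu> / 2 * (norm ((1 - t) *\<^sub>R a + t *\<^sub>R b))\<^sup>2
      \<le> (1 - t) * (f a - \<mu> / 2 * (norm a)\<^sup>2) + t * (f b - \<mu> / 2 * (norm b)\<^sup>2)"
      using assms(7)[unfolded strongly_convex_fun_def convex_fun_def, rule_format, of t a b]
      by (simp add: h)
  qed simp
  have D_ge: "\<mu> / 2 * (norm (a - b))\<^sup>2 \<le> D a b" for a b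
    unfolding D_def by (rule strongly_convex_real_bregman_ge[OF sconv grd])
  then have D0: "0 \<le> D a b" for a b
    using mu by (meson order_trans mult_nonneg_nonneg zero_le_power2 less_imp_le half_gt_zero)
  have conv: "convex_on UNIV f"
  proof (rule convex_onI)
    fix t :: real and a b :: "real ^ 'n" assume t: "0 < t" "t < 1"
    let ?m = "(1 - t) *\<^sub>R a + t *\<^sub>R b"
    \<comment> \<open>Average the tangent inequalities at the intermediate point; their linear parts cancel.\<close>
    have "0 \<le> (1 - t) * D a ?m + t * D b ?m" using t D0 by simp
    also have "\<dots> = (1 - t) * f a + t * f b - f ?m
        - inner (g ?m) ((1 - t) *\<^sub>R (a - ?m) + t *\<^sub>R (b - ?m))"
      unfolding D_def real_bregman_def inner_add_right inner_scaleR_right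
      by (simp add: algebra_simps)
    also have "(1 - t) *\<^sub>R (a - ?m) + t *\<^sub>R (b - ?m) = 0" by (simp add: algebra_simps)
    finally show "f ?m \<le> (1 - t) * f a + t * f b" by simp
  qed simp
  have breg: "bregman h a b = ereal (D a b)" for a b
    by (simp add: bregman_def h D_def real_bregman_def g_def)
  have op: "g (x k) - g (x (Suc k)) \<in> M (x (Suc k))" for k
    using assms(12)[of k] by (simp add: resolvent_def g_def)

  have dec: "D p (x (Suc k)) \<le> D p (x k) - c * D (x (Suc k)) (x k)"
    if "p \<in> weak_MVI_zeros \<rho> M" for p k
    unfolding D_def c_def by (rule bregman_step_decrease[OF conv grd lip assms(4) that op])
  have tele: "c * (\<Sum>i<k. D (x (Suc i)) (x i)) \<le> D p (x 0) - D p (x k)"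
    if "p \<in> weak_MVI_zeros \<rho> M" for p k
  proof (induction k)
    case (Suc k)
    then show ?case using dec[OF that, of k] by (simp add: algebra_simps)
  qed simp
  have antimono: "decseq (\<lambda>k. D p (x k))" if "p \<in> weak_MVI_zeros \<rho> M" for p
  proof (rule decseq_SucI)
    fix k
    have "0 \<le> c * D (x (Suc k)) (x k)" using c D0 by simp
    then show "D p (x (Suc k)) \<le> D p (x k)" using dec[OF that, of k] by linarith
  qed

  have rate: "(MIN i\<in>{1..k}. bregman h (x i) (x (i - 1)))
      \<le> bregman h p (x 0) / ereal ((1 - \<rho> * L) * real k)"
    if k: "k \<ge> 1" and p: "p \<in> weak_MVI_zeros \<rho> M" for k p
  proof -
    let ?B = "D p (x 0) / (c * real k)"
    have "\<exists>i<k. D (x (Suc i)) (x i) \<le> ?B"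
    proof (rule ccontr)
      assume "\<not> ?thesis"
      then have "(\<Sum>i<k. ?B) < (\<Sum>i<k. D (x (Suc i)) (x i))"
        using k by (intro sum_strict_mono) (auto simp: not_le lessThan_empty_iff)
      then have "c * (\<Sum>i<k. ?B) < c * (\<Sum>i<k. D (x (Suc i)) (x i))" using c by simp
      moreover have "c * (\<Sum>i<k. ?B) = D p (x 0)" using c k by simp
      ultimately show False using tele[OF p, of k] D0[of p "x k"] by linarith
    qed
    then obtain i where i: "i < k" "D (x (Suc i)) (x i) \<le> ?B" by blast
    have "(MIN i\<in>{1..k}. bregman h (x i) (x (i - 1))) \<le> bregman h (x (Suc i)) (x (Suc i - 1))"
      using i(1) by (intro Min_le imageI finite_imageI) auto
    also have "\<dots> \<le> ereal ?B" using i(2) by (simp add: breg)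
    also have "\<dots> = bregman h p (x 0) / ereal (c * real k)"
      using c k by (simp add: breg)
    finally show ?thesis by (simp add: c_def)
  qed

  obtain p0 where p0: "p0 \<in> weak_MVI_zeros \<rho> M"
    using assms(5) by (auto simp: weak_MVI_def weak_MVI_zeros_def)
  have "summable (\<lambda>k. D (x (Suc k)) (x k))"
  proof (rule summableI_nonneg_bounded)
    fix k
    show "(\<Sum>i<k. D (x (Suc i)) (x i)) \<le> D p0 (x 0) / c"
      using tele[OF p0, of k] D0[of p0 "x k"] c by (simp add: field_simps)
  qed (rule D0)
  then have step0: "(\<lambda>k. D (x (Suc k)) (x k)) \<longlonglongrightarrow> 0" by (rule summable_LIMSEQ_zero)
  have w0: "(\<lambda>k. g (x k) - g (x (Suc k))) \<longlonglongrightarrow> 0"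
  proof -
    have "(\<lambda>k. (norm (g (x k) - g (x (Suc k))))\<^sup>2) \<longlonglongrightarrow> 0"
    proof (rule tendsto_sandwich[where f = "\<lambda>_. 0"])
      show "(\<lambda>k. 2 * L * D (x (Suc k)) (x k)) \<longlonglongrightarrow> 0"
        using tendsto_mult_right_zero[OF step0] by simp
      show "eventually (\<lambda>k. (norm (g (x k) - g (x (Suc k))))\<^sup>2
          \<le> 2 * L * D (x (Suc k)) (x k)) sequentially"
        using gradient_cocoercive[OF conv grd lip]
        unfolding D_def by (intro always_eventually allI) (metis norm_minus_commute)
    qed auto
    then show ?thesis by (simp add: tendsto_norm_zero_iff)
  qed

  have limit: "p \<in> zeros M" if lp: "limit_point_of_seq x p" for p
  proof -
    obtain r where r: "strict_mono r" "(x \<circ> r) \<longlonglongrightarrow> p"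
      using lp by (auto simp: limit_point_of_seq_def)
    \<comment> \<open>The initial point need not lie in the domain of the operator, so the first term of the
      subsequence is dropped; from then on the index has a predecessor.\<close>
    let ?s = "\<lambda>k. r (Suc k) - 1"
    have pos: "Suc (?s k) = r (Suc k)" for k
      using seq_suble[OF r(1), of "Suc k"] by simp
    have "filterlim ?s at_top sequentially"
    proof (rule filterlim_at_top_mono[OF filterlim_ident])
      show "eventually (\<lambda>k. k \<le> ?s k) sequentially"
        using seq_suble[OF r(1)] by (intro always_eventually) (metis Suc_le_mono pos)
    qed
    from filterlim_compose[OF w0 this]
    have w: "(\<lambda>k. g (x (?s k)) - g (x (Suc (?s k)))) \<longlonglongrightarrow> 0" .
    have "(\<lambda>k. x (Suc (?s k))) \<longlonglongrightarrow> p"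
      using LIMSEQ_Suc[OF r(2)] by (simp only: pos o_def)
    from maximal_weakly_monotone_closed_graph[OF assms(3) op this w]
    show ?thesis by (simp add: zeros_def)
  qed

  have "\<exists>p\<in>weak_MVI_zeros \<rho> M. x \<longlonglongrightarrow> p" if eq: "weak_MVI_zeros \<rho> M = zeros M"
  proof -
    have "bounded (range x)"
    proof (rule boundedI)
      fix y assume "y \<in> range x"
      then obtain k where y: "y = x k" by blast
      have "\<mu> / 2 * (norm (p0 - x k))\<^sup>2 \<le> D p0 (x 0)"
        using D_ge[of p0 "x k"] decseqD[OF antimono[OF p0], of 0 k] by simp
      then have "(norm (p0 - x k))\<^sup>2 \<le> 2 * D p0 (x 0) / \<mu>"
        using mu by (simp add: field_simps)
      then have "norm (p0 - x k) \<le> sqrt (2 * D p0 (x 0) / \<mu>)"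
        by (rule real_le_rsqrt)
      then show "norm y \<le> norm p0 + sqrt (2 * D p0 (x 0) / \<mu>)"
        using norm_triangle_ineq4[of p0 "p0 - x k"] by (simp add: y)
    qed
    then obtain p r where r: "strict_mono r" "(x \<circ> r) \<longlonglongrightarrow> p"
      using bounded_imp_convergent_subsequence by blast
    then have "p \<in> zeros M" by (intro limit) (auto simp: limit_point_of_seq_def)
    then have p: "p \<in> weak_MVI_zeros \<rho> M" using eq by simp
    have fc: "isCont f z" for z using grd[of z] unfolding gderiv_def by (rule has_derivative_continuous)
    have gc: "isCont g z" for z
      using lipschitz_on_continuous_on[OF lip] by (simp add: continuous_on_eq_continuous_at)
    have "(\<lambda>k. D p ((x \<circ> r) k)) \<longlonglongrightarrow> f p - f p - inner (g p) (p - p)"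
      unfolding D_def real_bregman_def
      by (intro tendsto_intros isCont_tendsto_compose[OF fc] isCont_tendsto_compose[OF gc] r)
    then have sub: "(\<lambda>k. D p (x (r k))) \<longlonglongrightarrow> 0" by simp
    obtain l where l: "(\<lambda>k. D p (x k)) \<longlonglongrightarrow> l"
      using decseq_convergent[OF antimono[OF p], of 0] D0 by blast
    with sub have "l = 0"
      using LIMSEQ_subseq_LIMSEQ[OF l r(1)] LIMSEQ_unique by (fastforce simp: o_def)
    have "(\<lambda>k. (norm (p - x k))\<^sup>2) \<longlonglongrightarrow> 0"
    proof (rule tendsto_sandwich[where f = "\<lambda>_. 0"])
      show "(\<lambda>k. 2 / \<mu> * D p (x k)) \<longlonglongrightarrow> 0"
        using tendsto_mult_right_zero[OF l[unfolded \<open>l = 0\<close>]] .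
      show "eventually (\<lambda>k. (norm (p - x k))\<^sup>2 \<le> 2 / \<mu> * D p (x k)) sequentially"
      proof (intro always_eventually allI)
        fix k
        show "(norm (p - x k))\<^sup>2 \<le> 2 / \<mu> * D p (x k)"
          using D_ge[of p "x k"] mu by (simp add: field_simps)
      qed
    qed auto
    then have "(\<lambda>k. p - x k) \<longlonglongrightarrow> 0" by (simp add: tendsto_norm_zero_iff)
    then have "x \<longlonglongrightarrow> p"
      using tendsto_diff[OF tendsto_const[of p], of "\<lambda>k. p - x k" 0] by simp
    with p show ?thesis by blast
  qed
  with rate limit show ?thesis by blast
qed

end
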